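(* The object localization problem where $S$ is an axis-symmetric box is $4$-split-neighborly. That is: let $d\ge1$, let $r_1,\dots,r_d\ge0$ and $S=\{s\in\mathbb{Z}^d: |s_i|\le r_i \text{ for all } i\}$, let $\mathcal{X}=\mathbb{Z}^d$, for $z\in\mathbb{Z}^d$ let $h_z:\mathcal{X}\to\{0,1\}$ be $h_z(x)=\mathbf{1}[x-z\in S]$, and let $\mathcal{H}\subseteq\{h_z\}_{z\in\mathbb{Z}^d}$ be finite. Then $(\mathcal{H},\mathcal{X})$ is $4$-split-neighborly.
   Context: Elements of $\mathcal{H}$ are hypotheses, elements of $\mathcal{X}$ are tests. For a nonempty finite set $V$, $\mathbb{E}_{h\in V}[f(h)]=\frac{1}{|V|}\sum_{h\in V}f(h)$. For tests $x,x'$ let $\Delta(x,x')=\{h\in\mathcal{H}: h(x)=0 \wedge h(x')=1\}$. For $\alpha\in(0,\frac12]$, define a directed graph on $\mathcal{X}$ with a directed edge $(x,x')$ iff for every $V\subseteq\Delta(x,x')$, either $|V|\le 1$ or there exists a test $\hat x\in\mathcal{X}$ with $\mathbb{E}_{h\in V}[h(\hat x)]\in[\alpha,1-\alpha]$. The problem is $\frac1\alpha$-split-neighborly if this graph is strongly connected (so $4$-split-neighborly means $\alpha=1/4$). *)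

theory Defs
  imports
    "HOL-Analysis.Finite_Cartesian_Product"
    "Graph_Theory.Pair_Digraph"
    "Graph_Theory.Digraph_Component"
begin

text \<open>
  A hypothesis is a function from tests to \<open>{0, 1}\<close>. The two-element set is rendered as
  \<^typ>\<open>bool\<close>, with \<^const>\<open>False\<close> for 0 and \<^const>\<open>True\<close> for 1; inside averages
  \<^const>\<open>of_bool\<close> turns the value back into the number 0 or 1.
\<close>

type_synonym 'x hypothesis = "'x \<Rightarrow> bool"

text \<open>Meant for finite nonempty \<open>V\<close> only.\<close>

definition average :: "'h set \<Rightarrow> ('h \<Rightarrow> real) \<Rightarrow> real" where
  "average V f = 1 / real (card V) * (\<Sum>h\<in>V. f h)"

definition Delta :: "'x hypothesis set \<Rightarrow> 'x \<Rightarrow> 'x \<Rightarrow> 'x hypothesis set" where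
  "Delta H x x' = {h \<in> H. \<not> h x \<and> h x'}"

text \<open>
  \<open>H\<close> is the set of hypotheses and \<open>X\<close> the set of tests. \<open>H\<close> is meant to be finite, so that
  \<open>card V \<le> 1\<close> has its usual meaning.
\<close>

definition split_edge ::
    "real \<Rightarrow> 'x hypothesis set \<Rightarrow> 'x set \<Rightarrow> 'x \<Rightarrow> 'x \<Rightarrow> bool" where
  "split_edge \<alpha> H X x x' \<longleftrightarrow>
     (\<forall>V \<subseteq> Delta H x x'.
        card V \<le> 1 \<or> (\<exists>y\<in>X. average V (\<lambda>h. of_bool (h y)) \<in> {\<alpha>..1 - \<alpha>}))"

definition split_graph ::
    "real \<Rightarrow> 'x hypothesis set \<Rightarrow> 'x set \<Rightarrow> 'x pair_pre_digraph" where
  "split_graph \<alpha> H X =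
     \<lparr>pverts = X, parcs = {(x, x'). x \<in> X \<and> x' \<in> X \<and> split_edge \<alpha> H X x x'}\<rparr>"

text \<open>The parameter is \<open>k = 1 / \<alpha>\<close>, so \<open>\<alpha> \<in> (0, 1/2]\<close> becomes \<open>k \<ge> 2\<close>.\<close>

definition split_neighborly ::
    "real \<Rightarrow> 'x hypothesis set \<Rightarrow> 'x set \<Rightarrow> bool" where
  "split_neighborly k H X \<longleftrightarrow>
     2 \<le> k \<and> strongly_connected (with_proj (split_graph (1 / k) H X))"

definition localization_hypothesis ::
    "(int ^ 'd) set \<Rightarrow> int ^ 'd \<Rightarrow> (int ^ 'd) hypothesis" where
  "localization_hypothesis S z = (\<lambda>x. x - z \<in> S)"

definition axis_symmetric_box :: "('d \<Rightarrow> real) \<Rightarrow> (int ^ 'd) set" where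
  "axis_symmetric_box r = {s. \<forall>i. real_of_int \<bar>s $ i\<bar> \<le> r i}"

end

theory Submission
  imports Defs
begin

text \<open>
  Any two tests are joined by an edge. The hypotheses accepting a test \<open>x'\<close> have
  their centres in the box around \<open>x'\<close>, and on such centres a translate of the box can realise any
  orthant whose apex lies in the box. Splitting at a quartile in some coordinate either succeeds at
  once or finds a value \<open>t i\<close> with less than a quarter of the centres on either side. In the second
  case, imposing the constraints \<open>z i \<le> t i\<close> one after the other loses less than a quarter in each
  step, so the count cannot jump over the interval between one and three quarters; the same holds
  for \<open>z i \<ge> t i\<close>. If neither chain splits, two opposite orthants that share only their apex
  both contain more than three quarters of the centres, which is impossible for at least two centres.
\<close>

abbreviation quarter_split :: "'a set \<Rightarrow> ('a \<Rightarrow> bool) \<Rightarrow> bool" where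
  "quarter_split V P \<equiv>
     card V \<le> 4 * card {v \<in> V. P v} \<and> 4 * card {v \<in> V. P v} \<le> 3 * card V"

text \<open>Take the least attained value whose lower set holds at least a quarter of
  \<open>V\<close>; the maximum of \<open>f\<close> on \<open>V\<close> shows that one
  exists.\<close>

lemma lower_quartile:
  fixes f :: "'a \<Rightarrow> 'b::linorder"
  assumes "finite V" "V \<noteq> {}"
  obtains t where "t \<in> f ` V" "card V \<le> 4 * card {v \<in> V. f v \<le> t}"
    "4 * card {v \<in> V. f v < t} < card V"
proof -
  define T where "T = {t \<in> f ` V. card V \<le> 4 * card {v \<in> V. f v \<le> t}}"
  have fin: "finite T" using assms by (simp add: T_def)
  have "{v \<in> V. f v \<le> Max (f ` V)} = V" using assms by auto
  then have "Max (f ` V) \<in> T" using assms by (simp add: T_def)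
  then have min: "Min T \<in> T" using fin by (intro Min_in) auto
  have "4 * card {v \<in> V. f v < Min T} < card V"
  proof (cases "{v \<in> V. f v < Min T} = {}")
    case True
    show ?thesis unfolding True using assms by (simp add: card_gt_0_iff)
  next
    case False
    \<comment> \<open>\<open>s\<close> is the attained value just before \<open>Min T\<close>, so
      its weak lower set is the strict lower set of \<open>Min T\<close>, and minimality bounds the
      latter.\<close>
    define s where "s = Max (f ` {v \<in> V. f v < Min T})"
    have s: "s \<in> f ` {v \<in> V. f v < Min T}"
      unfolding s_def using False assms by (intro Max_in) auto
    have "v \<in> V \<Longrightarrow> f v < Min T \<Longrightarrow> f v \<le> s" for v
      unfolding s_def using assms by (intro Max_ge) auto
    then have eq: "{v \<in> V. f v \<le> s} = {v \<in> V. f v < Min T}" using s by auto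
    have "s \<notin> T" using s Min_le[OF fin, of s] by auto
    then have "4 * card {v \<in> V. f v \<le> s} < card V" using s by (auto simp: T_def)
    then show ?thesis unfolding eq .
  qed
  then show ?thesis using that min unfolding T_def by blast
qed

lemma quarter_split_chain:
  assumes "finite V" "finite I" "\<And>i. i \<in> I \<Longrightarrow> 4 * card {v \<in> V. \<not> P i v} < card V"
    and "\<And>J. J \<subseteq> I \<Longrightarrow> \<not> quarter_split V (\<lambda>v. \<forall>i\<in>J. P i v)"
    and "V \<noteq> {}"
  shows "3 * card V < 4 * card {v \<in> V. \<forall>i\<in>I. P i v}"
  using assms(2-4)
proof (induction I rule: finite_induct)
  case empty
  then show ?case using assms by (simp add: card_gt_0_iff)
next
  case (insert i I)
  have "3 * card V < 4 * card {v \<in> V. \<forall>i\<in>I. P i v}"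
    using insert.prems by (intro insert.IH) auto
  moreover have "card {v \<in> V. \<forall>i\<in>I. P i v}
      \<le> card ({v \<in> V. \<forall>j\<in>insert i I. P j v} \<union> {v \<in> V. \<not> P i v})"
    using assms(1) by (intro card_mono) auto
  moreover have "\<dots> \<le> card {v \<in> V. \<forall>j\<in>insert i I. P j v} + card {v \<in> V. \<not> P i v}"
    by (rule card_Un_le)
  moreover have "4 * card {v \<in> V. \<not> P i v} < card V"
    using insert.prems by auto
  moreover have "\<not> quarter_split V (\<lambda>v. \<forall>j\<in>insert i I. P j v)"
    using insert.prems(2) by blast
  \<comment> \<open>More than half of \<open>V\<close> survives the new constraint, so the split can
    only fail by exceeding three quarters.\<close>
  ultimately show ?case by linarith
qed

text \<open>Each \<open>t i\<close> is required to be attained so that, for centres in a box, the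
  apex stays in that box coordinate by coordinate.\<close>

lemma orthant_quarter_split:
  fixes p :: "'a \<Rightarrow> 'i::finite \<Rightarrow> 'b::linorder"
  assumes "finite V" "2 \<le> card V" "inj_on p V"
  obtains t I where "\<And>i. t i \<in> (\<lambda>v. p v i) ` V"
    "quarter_split V (\<lambda>v. \<forall>i\<in>I. p v i \<le> t i) \<or> quarter_split V (\<lambda>v. \<forall>i\<in>I. t i \<le> p v i)"
proof -
  have ne: "V \<noteq> {}" using assms by auto
  define Q where "Q i t \<longleftrightarrow> t \<in> (\<lambda>v. p v i) ` V \<and> card V \<le> 4 * card {v \<in> V. p v i \<le> t}
      \<and> 4 * card {v \<in> V. p v i < t} < card V" for i t
  have "\<exists>t. Q i t" for i
    unfolding Q_def
    by (rule lower_quartile[OF assms(1) ne, of "\<lambda>v. p v i"]) (intro exI conjI)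
  then obtain t where "\<And>i. Q i (t i)" by metis
  then have t: "\<And>i. t i \<in> (\<lambda>v. p v i) ` V"
      "\<And>i. card V \<le> 4 * card {v \<in> V. p v i \<le> t i}"
      "\<And>i. 4 * card {v \<in> V. p v i < t i} < card V"
    by (simp_all add: Q_def)
  have False if no: "\<And>I. \<not> quarter_split V (\<lambda>v. \<forall>i\<in>I. p v i \<le> t i)"
      "\<And>I. \<not> quarter_split V (\<lambda>v. \<forall>i\<in>I. t i \<le> p v i)"
  proof -
    let ?A = "{v \<in> V. \<forall>i\<in>UNIV. p v i \<le> t i}" and ?B = "{v \<in> V. \<forall>i\<in>UNIV. t i \<le> p v i}"
    have "4 * card {v \<in> V. \<not> p v i \<le> t i} < card V" for i
    proof -
      have "card V = card {v \<in> V. p v i \<le> t i} + card {v \<in> V. \<not> p v i \<le> t i}"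
        using card_Int_Diff[OF assms(1), of "{v. p v i \<le> t i}"] by (simp add: Int_def set_diff_eq)
      \<comment> \<open>The quartile gives the lower bound of the split for the single constraint
        \<open>i\<close>, so the upper bound must fail.\<close>
      then show ?thesis using no(1)[of "{i}"] t(2)[of i] by simp
    qed
    then have A: "3 * card V < 4 * card ?A"
      using no ne assms(1) by (intro quarter_split_chain) auto
    have "4 * card {v \<in> V. \<not> t i \<le> p v i} < card V" for i
      using t(3)[of i] by (simp add: not_le)
    then have B: "3 * card V < 4 * card ?B"
      using no ne assms(1) by (intro quarter_split_chain) auto
    \<comment> \<open>A common element has \<open>p v = t\<close>, and \<open>p\<close> is injective
      on \<open>V\<close>.\<close>
    have "card (?A \<inter> ?B) = card (p ` (?A \<inter> ?B))"
      using assms(3) by (intro card_image[symmetric]) (auto simp: inj_on_def)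
    also have "\<dots> \<le> card {t}"
      by (intro card_mono) (auto intro!: ext order.antisym)
    finally have "card (?A \<inter> ?B) \<le> 1" by simp
    moreover have "card (?A \<union> ?B) \<le> card V" using assms(1) by (intro card_mono) auto
    moreover have "card ?A + card ?B = card (?A \<union> ?B) + card (?A \<inter> ?B)"
      using assms(1) by (intro card_Un_Int) auto
    \<comment> \<open>By inclusion-exclusion the intersection holds more than half of at least two
      elements, hence more than one.\<close>
    ultimately show False using A B assms(2) by linarith
  qed
  then show ?thesis using that[of t] t(1) by blast
qed

lemma average_of_bool:
  assumes "finite V"
  shows "average V (\<lambda>v. of_bool (P v)) = real (card {v \<in> V. P v}) / real (card V)"
  using assms by (simp add: average_def Int_def)

lemma localization_hypothesis_box:
  "localization_hypothesis (axis_symmetric_box r) z x \<longleftrightarrow> (\<forall>i. \<bar>x $ i - z $ i\<bar> \<le> \<lfloor>r i\<rfloor>)"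
  by (simp add: localization_hypothesis_def axis_symmetric_box_def le_floor_iff)

lemma split_edge_box:
  fixes r :: "'d::finite \<Rightarrow> real"
  assumes H: "H \<subseteq> range (localization_hypothesis (axis_symmetric_box r))" and "finite H"
  shows "split_edge (1 / 4) H UNIV x x'"
  unfolding split_edge_def
proof (intro allI impI)
  fix V assume V: "V \<subseteq> Delta H x x'"
  let ?loc = "localization_hypothesis (axis_symmetric_box r)"
  have fin: "finite V" using V assms(2) by (auto simp: Delta_def intro: finite_subset)
  show "card V \<le> 1 \<or> (\<exists>y\<in>UNIV. average V (\<lambda>h. of_bool (h y)) \<in> {1 / 4..1 - 1 / 4})"
  proof (cases "card V \<le> 1")
    case False
    have "\<forall>h\<in>V. \<exists>z. h = ?loc z" using V H by (auto simp: Delta_def)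
    then obtain z where z: "\<And>h. h \<in> V \<Longrightarrow> h = ?loc (z h)" by metis
    have apply_h: "h y \<longleftrightarrow> (\<forall>i. \<bar>y $ i - z h $ i\<bar> \<le> \<lfloor>r i\<rfloor>)" if "h \<in> V" for h y
      by (subst z[OF that]) (rule localization_hypothesis_box)
    have near: "\<bar>x' $ i - z h $ i\<bar> \<le> \<lfloor>r i\<rfloor>" if "h \<in> V" for h i
      using apply_h[OF that] V that by (auto simp: Delta_def)
    \<comment> \<open>A centre determines its hypothesis.\<close>
    have "inj_on (\<lambda>h i. z h $ i) V"
      by (rule inj_onI) (metis z vec_eq_iff)
    then obtain t I where t: "\<And>i. t i \<in> (\<lambda>h. z h $ i) ` V"
        and split: "quarter_split V (\<lambda>h. \<forall>i\<in>I. z h $ i \<le> t i) \<or>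
          quarter_split V (\<lambda>h. \<forall>i\<in>I. t i \<le> z h $ i)"
      using orthant_quarter_split[of V "\<lambda>h i. z h $ i"] fin False by auto
    have t_near: "\<bar>x' $ i - t i\<bar> \<le> \<lfloor>r i\<rfloor>" for i
      using t[of i] near by auto
    \<comment> \<open>On \<open>I\<close> the box around \<open>lo\<close> has its upper face at
      \<open>t i\<close>. Its lower face excludes no centre, since \<open>t i\<close> and every
      \<open>z h $ i\<close> lie within the radius of \<open>x' $ i\<close>. Off \<open>I\<close>
      the coordinate of \<open>x'\<close> imposes nothing on \<open>V\<close>. \<open>hi\<close> is
      the mirror image.\<close>
    define lo where "lo = (\<chi> i. if i \<in> I then t i - \<lfloor>r i\<rfloor> else x' $ i)"
    define hi where "hi = (\<chi> i. if i \<in> I then t i + \<lfloor>r i\<rfloor> else x' $ i)"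
    have lo: "\<bar>lo $ i - z h $ i\<bar> \<le> \<lfloor>r i\<rfloor> \<longleftrightarrow> (i \<in> I \<longrightarrow> z h $ i \<le> t i)"
      and hi: "\<bar>hi $ i - z h $ i\<bar> \<le> \<lfloor>r i\<rfloor> \<longleftrightarrow> (i \<in> I \<longrightarrow> t i \<le> z h $ i)" if "h \<in> V" for h i
      using near[OF that, of i] t_near[of i] by (auto simp: lo_def hi_def)
    have "h lo \<longleftrightarrow> (\<forall>i\<in>I. z h $ i \<le> t i)" "h hi \<longleftrightarrow> (\<forall>i\<in>I. t i \<le> z h $ i)" if "h \<in> V" for h
      by (simp_all only: apply_h[OF that] lo[OF that] hi[OF that] Ball_def)
    then have "{h \<in> V. h lo} = {h \<in> V. \<forall>i\<in>I. z h $ i \<le> t i}"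
      "{h \<in> V. h hi} = {h \<in> V. \<forall>i\<in>I. t i \<le> z h $ i}"
      by auto
    then have "quarter_split V (\<lambda>h. h lo) \<or> quarter_split V (\<lambda>h. h hi)"
      using split by simp
    then obtain y where y: "quarter_split V (\<lambda>h. h y)" by (elim disjE that)
    have "average V (\<lambda>h. of_bool (h y)) \<in> {1 / 4..1 - 1 / 4}"
      using y False fin by (simp add: average_of_bool field_simps)
    then show ?thesis by blast
  qed simp
qed

theorem theorem4p3:
  fixes r :: "'d::finite \<Rightarrow> real"
    and H :: "(int ^ 'd) hypothesis set"
  assumes "\<And>i. r i \<ge> 0"
    and "H \<subseteq> range (localization_hypothesis (axis_symmetric_box r))"
    and "finite H"
  shows "split_neighborly 4 H (UNIV :: (int ^ 'd) set)"
proof -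
  let ?G = "split_graph (1 / 4) H (UNIV :: (int ^ 'd) set)"
  have "parcs ?G = UNIV" "pverts ?G = UNIV"
    using split_edge_box[OF assms(2,3)] by (auto simp: split_graph_def)
  \<comment> \<open>The digraph is complete, so one arc suffices.\<close>
  then have "u \<rightarrow>\<^sup>*\<^bsub>with_proj ?G\<^esub> v" for u v
    unfolding reachable_def by (intro rtrancl_on_into_rtrancl_on[OF rtrancl_on_refl])
      (auto simp: arcs_ends_def arc_to_ends_def)
  then show ?thesis
    using \<open>pverts ?G = UNIV\<close> by (simp add: split_neighborly_def strongly_connected_def)
qed

end
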